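(* Let $\kappa=2.01\pi$. The Riemann zeta function has no nontrivial zero $s=\sigma+it$ ($\sigma,t\in\mathbb{R}$) with $2\pi<|t|<\kappa$ and with either $0\leq\sigma<\tfrac12$ or $\tfrac12<\sigma\leq 1$.
   Context: $\zeta$ denotes the Riemann zeta function, meromorphically continued to $\mathbb{C}$. The trivial zeros of $\zeta$ are $s=-2n$, $n=1,2,3,\dots$; all other zeros of $\zeta$ are called nontrivial. *)

theory Defs
  imports "HOL-Complex_Analysis.Complex_Analysis"
begin

definition zeta_series :: "complex \<Rightarrow> complex" where
  "zeta_series s = (\<Sum>n. 1 / of_nat (Suc n) powr s)"

text \<open>
  The meromorphic continuation of the series to the whole plane. The requirement
  \<^const>\<open>nicely_meromorphic_on\<close> rules out removable singularities and sets the value to 0 at poles,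
  which makes the continuation unique as a total function; existence and uniqueness are proved below.
\<close>
definition riemann_zeta :: "complex \<Rightarrow> complex" where
  "riemann_zeta = (THE f. f nicely_meromorphic_on UNIV \<and> (\<forall>s. Re s > 1 \<longrightarrow> f s = zeta_series s))"

definition trivial_zeta_zeros :: "complex set" where
  "trivial_zeta_zeros = {- 2 * of_nat n | n. n \<ge> 1}"

text \<open>The value 0 at the pole is only a convention and does not count as a zero.\<close>
definition nontrivial_zeta_zero :: "complex \<Rightarrow> bool" where
  "nontrivial_zeta_zero s \<longleftrightarrow>
     riemann_zeta s = 0 \<and> \<not> is_pole riemann_zeta s \<and> s \<notin> trivial_zeta_zeros"

definition kappa :: real where
  "kappa = 2.01 * pi"

text \<open>
  Existence of the continuation. For \<open>Re s > 1\<close>, Taylor expansion of \<open>(n + 1) powr (1 - s)\<close> around \<open>n\<close>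
  and telescoping express \<open>(s - 1) * zeta_series s\<close> through the same function at
  \<open>s + 1, ..., s + K - 1\<close> and a series of remainders that is holomorphic for \<open>Re s > 1 - K\<close>.
\<close>

definition ffac :: "nat \<Rightarrow> complex \<Rightarrow> complex" where
  "ffac i a = (\<Prod>l<i. a - of_nat l)"

definition taylor_rem :: "nat \<Rightarrow> nat \<Rightarrow> complex \<Rightarrow> complex" where
  "taylor_rem K n s = of_nat (Suc (Suc n)) powr (1 - s) -
     (\<Sum>i\<le>K. ffac i (1 - s) / fact i * of_nat (Suc n) powr (1 - s - of_nat i))"

lemma ffac_0: "ffac 0 a = 1"
  by (simp add: ffac_def)

lemma norm_taylor_rem_le:
  assumes "Re s + real K > 1"
  shows "norm (taylor_rem K n s) \<le> norm (ffac (Suc K) (1 - s)) * real (Suc n) powr (- Re s - real K)"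
proof -
  define a where "a = 1 - s"
  define x where "x = real (Suc n)"
  define f where "f = (\<lambda>i z. ffac i a * z powr (a - of_nat i))"
  define S where "S = closed_segment (complex_of_real x) (of_real (x+1))"
  have x: "x > 0" by (simp add: x_def)
  have S: "\<exists>t. z = of_real t \<and> t \<ge> x" if "z \<in> S" for z
    using that unfolding S_def closed_segment_of_real closed_segment_eq_real_ivl by auto
  have "cmod (f 0 (of_real (x+1)) - (\<Sum>i\<le>K. f i (of_real x) * (of_real (x+1) - of_real x) ^ i / (fact i))) 
     \<le> (norm (ffac (Suc K) a) * x powr (- Re s - real K)) * cmod (of_real (x+1) - of_real x)^(Suc K) / fact K"
  proof (rule complex_Taylor[where S = S])
    show "convex S" by (simp add: S_def)
    show "complex_of_real x \<in> S" "complex_of_real (x+1) \<in> S" by (simp_all add: S_def)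
    fix z assume z: "z \<in> S"
    then obtain t where t: "z = of_real t" "t \<ge> x" using S by blast
    have nz: "z \<notin> \<real>\<^sub>\<le>\<^sub>0" using t x by simp
    show "(f i has_field_derivative f (Suc i) z) (at z within S)" for i
    proof -
      have "((\<lambda>z. ffac i a * z powr (a - of_nat i)) has_field_derivative
              ffac i a * ((a - of_nat i) * z powr (a - of_nat i - 1))) (at z within S)"
        by (intro DERIV_cmult has_field_derivative_at_within[OF has_field_derivative_powr[OF nz]])
      moreover have "a - of_nat i - 1 = a - of_nat (Suc i)" by simp
      moreover have "ffac (Suc i) a = ffac i a * (a - of_nat i)" by (simp add: ffac_def)
      ultimately show ?thesis unfolding f_def by (simp only: mult.assoc)
    qed
    have "norm (z powr (a - of_nat (Suc K))) = t powr (- Re s - real K)"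
      using t x by (subst norm_powr_real_powr) (simp_all add: a_def)
    also have "\<dots> \<le> x powr (- Re s - real K)"
      using t x assms by (intro powr_mono2') auto
    finally show "norm (f (Suc K) z) \<le> norm (ffac (Suc K) a) * x powr (- Re s - real K)"
      unfolding f_def norm_mult by (intro mult_left_mono) auto
  qed
  also have "\<dots> \<le> norm (ffac (Suc K) a) * x powr (- Re s - real K)"
  proof -
    have "0 \<le> norm (ffac (Suc K) a) * x powr (- Re s - real K)" by simp
    from mult_left_mono[OF fact_ge_1[of K] this] show ?thesis
      by (simp add: divide_le_eq)
  qed
  also have "f 0 (of_real (x+1)) - (\<Sum>i\<le>K. f i (of_real x) * (of_real (x+1) - of_real x) ^ i / (fact i)) = taylor_rem K n s"
    by (simp add: taylor_rem_def f_def a_def x_def ffac_def add_ac)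
  finally show ?thesis by (simp add: a_def x_def)
qed

lemma holomorphic_ffac [holomorphic_intros]:
  "f holomorphic_on A \<Longrightarrow> (\<lambda>s. ffac i (f s)) holomorphic_on A"
  unfolding ffac_def by (intro holomorphic_intros)

lemma holomorphic_taylor_rem [holomorphic_intros]: "taylor_rem K n holomorphic_on A"
proof -
  have "of_nat (Suc m) \<noteq> (0::complex)" for m using of_nat_neq_0 .
  then show ?thesis
  unfolding taylor_rem_def[abs_def] by (intro holomorphic_intros) auto
qed

lemma summable_Suc_powr: "c < -1 \<Longrightarrow> summable (\<lambda>n. real (Suc n) powr c)"
  using summable_real_powr_iff[of c] by (subst summable_Suc_iff) simp

lemma summable_taylor_rem:
  assumes "Re s + real K > 1" shows "summable (\<lambda>n. taylor_rem K n s)"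
  by (rule summable_comparison_test'[OF summable_mult[OF summable_Suc_powr] norm_taylor_rem_le])
     (use assms in auto)

lemma holomorphic_suminf_taylor_rem:
  "(\<lambda>s. \<Sum>n. taylor_rem K n s) holomorphic_on {s. Re s > 1 - real K}"
proof (rule holomorphic_uniform_sequence)
  show op: "open {s. Re s > 1 - real K}" by (rule open_halfspace_Re_gt)
  show "(\<lambda>s. \<Sum>i<n. taylor_rem K i s) holomorphic_on {s. Re s > 1 - real K}" for n
    by (intro holomorphic_intros)
  fix s0 assume s0: "s0 \<in> {s. Re s > 1 - real K}"
  define d where "d = (Re s0 - (1 - real K)) / 2"
  define c where "c = Re s0 - d"
  have d: "d > 0" using s0 by (simp add: d_def)
  have c: "c + real K > 1" using s0 unfolding c_def d_def by (simp add: field_simps)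
  have ge: "Re s \<ge> c" if "s \<in> cball s0 d" for s
  proof -
    have "\<bar>Re (s0 - s)\<bar> \<le> d" using that abs_Re_le_cmod[of "s0 - s"] by (simp add: dist_norm)
    thus ?thesis by (simp add: c_def)
  qed
  have "(\<lambda>s. ffac (Suc K) (1 - s)) holomorphic_on cball s0 d"
    by (intro holomorphic_intros)
  hence "bounded ((\<lambda>s. ffac (Suc K) (1 - s)) ` cball s0 d)"
    by (intro compact_imp_bounded compact_continuous_image holomorphic_on_imp_continuous_on) auto
  then obtain B where B: "norm (ffac (Suc K) (1 - s)) \<le> B" if "s \<in> cball s0 d" for s
    unfolding bounded_iff by blast
  have "uniform_limit (cball s0 d) (\<lambda>n s. \<Sum>i<n. taylor_rem K i s) (\<lambda>s. \<Sum>n. taylor_rem K n s) sequentially"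
  proof (rule Weierstrass_m_test)
    show "summable (\<lambda>n. B * real (Suc n) powr (- c - real K))"
      using c by (intro summable_mult summable_Suc_powr) auto
    fix n s assume s: "s \<in> cball s0 d"
    have "norm (taylor_rem K n s) \<le> norm (ffac (Suc K) (1 - s)) * real (Suc n) powr (- Re s - real K)"
      using ge[OF s] c by (intro norm_taylor_rem_le) auto
    also have "\<dots> \<le> B * real (Suc n) powr (- c - real K)"
      using B[OF s] ge[OF s] by (intro mult_mono powr_mono order_trans[OF norm_ge_zero B[OF s]]) auto
    finally show "norm (taylor_rem K n s) \<le> B * real (Suc n) powr (- c - real K)" .
  qed
  moreover have "cball s0 d \<subseteq> {s. Re s > 1 - real K}" using ge c by fastforce
  ultimately show "\<exists>d>0. cball s0 d \<subseteq> {s. Re s > 1 - real K} \<and> uniform_limit (cball s0 d) (\<lambda>n s. \<Sum>i<n. taylor_rem K i s) (\<lambda>s. \<Sum>n. taylor_rem K n s) sequentially"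
    using d by blast
qed

lemma zeta_series_sums:
  assumes "Re s > 1"
  shows "(\<lambda>n. of_nat (Suc n) powr (-s)) sums zeta_series s"
proof -
  have "summable (\<lambda>n. of_nat (Suc n) powr (-s) :: complex)"
  proof (rule summable_comparison_test')
    show "summable (\<lambda>n. real (Suc n) powr (- Re s))" using assms by (intro summable_Suc_powr) auto
    show "norm (of_nat (Suc n) powr (-s) :: complex) \<le> real (Suc n) powr (- Re s)" for n
      by (subst norm_powr_real_powr) auto
  qed
  moreover have "(\<lambda>n. of_nat (Suc n) powr (-s) :: complex) = (\<lambda>n. 1 / of_nat (Suc n) powr s)"
    by (intro ext) (simp add: powr_minus field_simps)
  ultimately show ?thesis unfolding zeta_series_def by (simp add: summable_sums)
qed

lemma zeta_series_recurrence:
  assumes s: "Re s > 1" and K: "K \<ge> 1"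
  shows "(s - 1) * zeta_series s = 1 + (\<Sum>i=2..K. - ffac (i-1) (1-s) / fact i * ((s + of_nat (i-1) - 1) * zeta_series (s + of_nat (i-1))))
           + (\<Sum>n. taylor_rem K n s)"
proof -
  have aux: "a / f * (- b * d) = - a / f * (b * d)" for a b d f :: complex by simp
  have aux2: "(s - 1) * z = 1 + q + t" if "t + ((1 - s) * z + q) = -1" for z q t :: complex
  proof -
    have "(s - 1) * z - (1 + q + t) = - (t + ((1 - s) * z + q)) - 1" by (simp add: algebra_simps)
    thus ?thesis using that by simp
  qed
  let ?x = "\<lambda>n. of_nat (Suc n) :: complex"
  have "(\<lambda>n. ?x n powr (1 - s)) \<longlonglongrightarrow> 0"
  proof (rule tendsto_norm_zero_cancel)
    have "(\<lambda>n. real (Suc n) powr (1 - Re s)) \<longlonglongrightarrow> 0" using s by real_asymp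
    also have "(\<lambda>n. real (Suc n) powr (1 - Re s)) = (\<lambda>n. norm (?x n powr (1 - s)))"
      by (intro ext, subst norm_powr_real_powr) auto
    finally show "(\<lambda>n. norm (?x n powr (1 - s))) \<longlonglongrightarrow> 0" .
  qed
  from telescope_sums[OF this] have 1: "(\<lambda>n. ?x (Suc n) powr (1 - s) - ?x n powr (1 - s)) sums (0 - 1)"
    by simp
  have "(\<lambda>n. taylor_rem K n s + (\<Sum>i=1..K. ffac i (1-s) / fact i * ?x n powr (- (s + of_nat (i-1)))))
     sums ((\<Sum>n. taylor_rem K n s) + (\<Sum>i=1..K. ffac i (1-s) / fact i * zeta_series (s + of_nat (i-1))))"
    using s by (intro sums_add summable_sums summable_taylor_rem sums_sum sums_mult zeta_series_sums) auto
  also have "(\<lambda>n. taylor_rem K n s + (\<Sum>i=1..K. ffac i (1-s) / fact i * ?x n powr (- (s + of_nat (i-1))))) = 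
     (\<lambda>n. ?x (Suc n) powr (1 - s) - ?x n powr (1 - s))"
  proof
    fix n
    have "{..K} = insert 0 {1..K}" by auto
    hence "taylor_rem K n s = ?x (Suc n) powr (1 - s) - ?x n powr (1 - s) -
        (\<Sum>i=1..K. ffac i (1-s) / fact i * ?x n powr (1 - s - of_nat i))"
      unfolding taylor_rem_def by (simp add: ffac_def)
    moreover have "(\<Sum>i=1..K. ffac i (1-s) / fact i * ?x n powr (1 - s - of_nat i)) =
       (\<Sum>i=1..K. ffac i (1-s) / fact i * ?x n powr (- (s + of_nat (i-1))))"
      by (intro sum.cong refl arg_cong2[of _ _ _ _ "(*)"] arg_cong2[of _ _ _ _ "(powr)"]) (auto simp: of_nat_diff)
    ultimately show "taylor_rem K n s + (\<Sum>i=1..K. ffac i (1-s) / fact i * ?x n powr (- (s + of_nat (i-1)))) = 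
      ?x (Suc n) powr (1 - s) - ?x n powr (1 - s)" by simp
  qed
  finally have eq: "(\<Sum>n. taylor_rem K n s) + (\<Sum>i=1..K. ffac i (1-s) / fact i * zeta_series (s + of_nat (i-1))) = -1"
    using 1 sums_unique2 by fastforce
  have "{1..K} = insert 1 {2..K}" using K by auto
  hence "(\<Sum>i=1..K. ffac i (1-s) / fact i * zeta_series (s + of_nat (i-1))) =
     (1 - s) * zeta_series s + (\<Sum>i=2..K. ffac i (1-s) / fact i * zeta_series (s + of_nat (i-1)))"
    by (simp add: ffac_def)
  moreover have "(\<Sum>i=2..K. ffac i (1-s) / fact i * zeta_series (s + of_nat (i-1))) =
     (\<Sum>i=2..K. ffac (i-1) (1-s) / fact i * (- (s + of_nat (i-1) - 1) * zeta_series (s + of_nat (i-1))))"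
  proof (rule sum.cong[OF refl])
    fix i assume "i \<in> {2..K}"
    then obtain j where j: "i = Suc j" by (cases i) auto
    show "ffac i (1-s) / fact i * zeta_series (s + of_nat (i-1)) = 
      ffac (i-1) (1-s) / fact i * (- (s + of_nat (i-1) - 1) * zeta_series (s + of_nat (i-1)))"
      unfolding j by (simp add: ffac_def del: fact_Suc) 
  qed
  moreover have "(\<Sum>i=2..K. ffac (i-1) (1-s) / fact i * (- (s + of_nat (i-1) - 1) * zeta_series (s + of_nat (i-1)))) =
     (\<Sum>i=2..K. - ffac (i-1) (1-s) / fact i * ((s + of_nat (i-1) - 1) * zeta_series (s + of_nat (i-1))))" (is "_ = ?S")
    by (intro sum.cong refl aux)
  ultimately have "(\<Sum>n. taylor_rem K n s) + ((1 - s) * zeta_series s + ?S) = -1" 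
    using eq by (simp only:)
  thus ?thesis by (rule aux2)
qed

lemma zeta_aux_halfplane:
  "\<exists>g. g holomorphic_on {s. Re s > - real k} \<and> g 1 = 1 \<and>
       (\<forall>s. Re s > 1 \<longrightarrow> g s = (s - 1) * zeta_series s)"
proof (induction k)
  have rem1: "taylor_rem K n 1 = 0" for K n
  proof -
    have "{..K} = insert 0 {1..K}" by auto
    moreover have "ffac i 0 = 0" if "i \<ge> 1" for i using that by (auto simp: ffac_def)
    ultimately show ?thesis by (simp add: taylor_rem_def ffac_0 del: of_nat_Suc)
  qed
  have step: "\<exists>g. g holomorphic_on {s. Re s > - real k} \<and> g 1 = 1 \<and>
       (\<forall>s. Re s > 1 \<longrightarrow> g s = (s - 1) * zeta_series s)"
    if h: "k = 0 \<or> h holomorphic_on {s. Re s > 1 - real k} \<and> (\<forall>s. Re s > 1 \<longrightarrow> h s = (s - 1) * zeta_series s)" for k h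
  proof (intro exI conjI allI impI)
    let ?g = "\<lambda>s. 1 + (\<Sum>i=2..Suc k. - ffac (i-1) (1-s) / fact i * h (s + of_nat (i-1))) + (\<Sum>n. taylor_rem (Suc k) n s)"
    have "(\<lambda>s. h (s + of_nat (i-1))) holomorphic_on {s. Re s > - real k}" if "i \<in> {2..Suc k}" for i
    proof -
      have "(h \<circ> (\<lambda>s. s + of_nat (i-1))) holomorphic_on {s. Re s > - real k}"
      proof (rule holomorphic_on_compose_gen)
        show "h holomorphic_on {s. Re s > 1 - real k}" using h that by auto
        show "(\<lambda>s. s + of_nat (i-1)) ` {s. Re s > - real k} \<subseteq> {s. Re s > 1 - real k}"
          using that by (auto simp: of_nat_diff)
      qed (intro holomorphic_intros)
      thus ?thesis by (simp add: o_def)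
    qed
    moreover have "(\<lambda>s. \<Sum>n. taylor_rem (Suc k) n s) holomorphic_on {s. Re s > - real k}"
      using holomorphic_suminf_taylor_rem[of "Suc k"] by simp
    ultimately show "?g holomorphic_on {s. Re s > - real k}"
      by (intro holomorphic_intros) auto
    have "ffac (i-1) 0 = 0" if "i \<in> {2..Suc k}" for i using that by (auto simp: ffac_def)
    thus "?g 1 = 1" by (simp add: rem1)
    fix s :: complex assume s: "Re s > 1"
    have "h (s + of_nat (i-1)) = (s + of_nat (i-1) - 1) * zeta_series (s + of_nat (i-1))" if "i \<in> {2..Suc k}" for i
      using h that s by auto
    thus "?g s = (s - 1) * zeta_series s"
      by (subst zeta_series_recurrence[OF s, of "Suc k"]) auto
  qed
  case 0
  show ?case using step[of 0] by blast
  case (Suc k)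
  then obtain h where "h holomorphic_on {s. Re s > - real k}" "\<forall>s. Re s > 1 \<longrightarrow> h s = (s - 1) * zeta_series s" by blast
  thus ?case using step[of "Suc k" h] by auto
qed

lemma zeta_aux_entire:
  "\<exists>g. g holomorphic_on UNIV \<and> g 1 = 1 \<and> (\<forall>s. Re s > 1 \<longrightarrow> g s = (s - 1) * zeta_series s)"
proof -
  from zeta_aux_halfplane obtain g where
    g: "\<And>k. g k holomorphic_on {s. Re s > - real k}" "\<And>k. g k 1 = 1" 
       "\<And>k s. Re s > 1 \<Longrightarrow> g k s = (s - 1) * zeta_series s" by metis
  have agree: "g k s = g l s" if "Re s > - real k" "k \<le> l" for k l s
  proof (rule analytic_continuation_open[where f = "g k" and g = "g l" and s = "{s. Re s > 1}" and s' = "{s. Re s > - real k}"])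
    show "{s. Re s > 1} \<noteq> {}" by (auto intro: exI[of _ 2])
    show "connected {s. Re s > - real k}" by (intro convex_connected convex_halfspace_Re_gt)
    show "g l holomorphic_on {s. Re s > - real k}" 
      by (rule holomorphic_on_subset[OF g(1)]) (use that in auto)
  qed (use g that in \<open>auto simp: open_halfspace_Re_gt\<close>)
  have agree: "g k s = g l s" if "Re s > - real k" "Re s > - real l" for k l s
  proof (cases "k \<le> l")
    case True
    show ?thesis by (rule agree[OF that(1) True])
  next
    case False
    hence "l \<le> k" by simp
    from agree[OF that(2) this] show ?thesis by (rule sym)
  qed
  define N where "N = (\<lambda>s. nat \<lceil>\<bar>Re s\<bar>\<rceil> + 1)"
  have N: "Re s > - real (N s)" for s
    unfolding N_def by linarith
  have G: "g (N s) s = g k s" if "Re s > - real k" for s k using agree[OF N that] .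
  have "(\<lambda>s. g (N s) s) holomorphic_on (\<Union>k. {s. Re s > - real k})"
    by (rule holomorphic_on_UN_open)
       (auto intro!: open_halfspace_Re_gt intro: holomorphic_transform[OF g(1)] simp: G)
  moreover have "(\<Union>k. {s. Re s > - real k}) = UNIV" using N by blast
  ultimately show ?thesis using g by (intro exI[of _ "\<lambda>s. g (N s) s"]) auto
qed

lemma nicely_meromorphic_eqI:
  assumes f: "f nicely_meromorphic_on UNIV" and g: "g nicely_meromorphic_on UNIV"
      and eq: "open A" "A \<noteq> {}" "\<And>z. z \<in> A \<Longrightarrow> f z = g z"
  shows "f = g"
proof
  fix z
  let ?d = "\<lambda>z. f z - g z"
  have mero: "?d meromorphic_on UNIV"
    using f g by (intro meromorphic_intros) (auto simp: nicely_meromorphic_on_def)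
  obtain a where a: "a \<in> A" using eq by blast
  have "eventually (\<lambda>z. z \<in> A) (at a)" using eq a by (simp add: eventually_at_in_open')
  moreover have "eventually (\<lambda>z. remove_sings ?d z = ?d z) (at w)" for w
    using eventually_remove_sings_eq_at[OF meromorphic_on_isolated_singularity[OF meromorphic_on_subset[OF mero]]] by simp
  hence ev: "eventually (\<lambda>z. remove_sings ?d z = ?d z) (at w)" for w .
  ultimately have "eventually (\<lambda>z. remove_sings ?d z = 0) (at a)"
    using ev[of a] by eventually_elim (use eq in auto)
  hence "frequently (\<lambda>z. remove_sings ?d z = 0) (at a)"
    by (intro eventually_frequently) auto
  hence zero: "remove_sings ?d w = 0" for w
    by (rule frequently_eq_meromorphic_imp_constant[OF _ remove_sings_nicely_meromorphic[OF mero]]) auto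
  have ev: "eventually (\<lambda>w. f w = g w) (at z)" using ev[of z] by eventually_elim (simp add: zero)
  have p: "is_pole f z \<longleftrightarrow> is_pole g z" by (rule is_pole_cong[OF ev refl])
  have l: "f \<midarrow>z\<rightarrow> c \<longleftrightarrow> g \<midarrow>z\<rightarrow> c" for c by (rule tendsto_cong[OF ev])
  show "f z = g z"
    using f g p l unfolding nicely_meromorphic_on_def
    by (metis LIM_unique UNIV_I not_tendsto_and_filterlim_at_infinity at_neq_bot is_pole_def)
qed

lemma zeta_exists:
  "\<exists>f. f nicely_meromorphic_on UNIV \<and> (\<forall>s. Re s > 1 \<longrightarrow> f s = zeta_series s) \<and> f holomorphic_on -{1} \<and> is_pole f 1"
proof -
  obtain g where g: "g holomorphic_on UNIV" "g 1 = 1" "\<And>s. Re s > 1 \<Longrightarrow> g s = (s - 1) * zeta_series s"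
    using zeta_aux_entire by blast
  let ?f = "\<lambda>s. g s / (s - 1)"
  have holo: "?f holomorphic_on -{1}"
    by (intro holomorphic_intros holomorphic_on_subset[OF g(1)]) auto
  have pole: "is_pole ?f 1"
  proof (rule is_pole_divide)
    show "isCont g 1" using holomorphic_on_imp_continuous_on[OF g(1)] by (simp add: continuous_on_eq_continuous_at)
    show "filterlim (\<lambda>s. s - 1) (at 0) (at (1::complex))"
      by (rule filterlim_atI) (auto intro!: tendsto_eq_intros simp: eventually_at_filter)
  qed (use g in auto)
  have "?f nicely_meromorphic_on UNIV"
  proof (rule nicely_meromorphic_onI_open)
    show an: "?f analytic_on UNIV - {1}" using holo by (subst analytic_on_open) (auto simp: Compl_eq_Diff_UNIV)
    show "isolated_singularity_at ?f x" for x
    proof (cases "x = 1")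
      case True
      then show ?thesis using holo isolated_singularity_at_holomorphic[of ?f UNIV 1]
        by (auto simp: Compl_eq_Diff_UNIV)
    next
      case False
      then have "?f analytic_on {x}" by (intro analytic_on_subset[OF an]) auto
      then show ?thesis by (rule isolated_singularity_at_analytic)
    qed
  qed (use pole in auto)
  moreover have "?f s = zeta_series s" if "Re s > 1" for s using g(3)[OF that] that by auto
  ultimately show ?thesis using holo pole by blast
qed

lemma zeta_ex1:
  "\<exists>!f. f nicely_meromorphic_on UNIV \<and> (\<forall>s. Re s > 1 \<longrightarrow> f s = zeta_series s)"
proof (rule ex_ex1I)
  show "\<exists>f. f nicely_meromorphic_on UNIV \<and> (\<forall>s. Re s > 1 \<longrightarrow> f s = zeta_series s)"
    using zeta_exists by blast
next
  fix f g :: "complex \<Rightarrow> complex"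
  assume f: "f nicely_meromorphic_on UNIV \<and> (\<forall>s. Re s > 1 \<longrightarrow> f s = zeta_series s)"
     and g: "g nicely_meromorphic_on UNIV \<and> (\<forall>s. Re s > 1 \<longrightarrow> g s = zeta_series s)"
  show "f = g"
  proof (rule nicely_meromorphic_eqI[where A = "{s. Re s > 1}"])
    show "f nicely_meromorphic_on UNIV" "g nicely_meromorphic_on UNIV" using f g by blast+
    show "open {s. Re s > 1}" by (rule open_halfspace_Re_gt)
    have "2 \<in> {s. Re s > 1}" by simp
    thus "{s. Re s > 1} \<noteq> {}" by blast
    show "f z = g z" if "z \<in> {s. Re s > 1}" for z using f g that by simp
  qed
qed

lemma riemann_zeta_eqI:
  assumes "f nicely_meromorphic_on UNIV" "\<And>s. Re s > 1 \<Longrightarrow> f s = zeta_series s"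
  shows   "riemann_zeta = f"
  unfolding riemann_zeta_def by (rule the1_equality[OF zeta_ex1]) (use assms in auto)

lemma riemann_zeta_nicely_meromorphic: "riemann_zeta nicely_meromorphic_on UNIV"
  and riemann_zeta_eq_series: "Re s > 1 \<Longrightarrow> riemann_zeta s = zeta_series s"
  using theI'[OF zeta_ex1] unfolding riemann_zeta_def by blast+

lemma riemann_zeta_holomorphic: "riemann_zeta holomorphic_on -{1}"
  and is_pole_riemann_zeta_1: "is_pole riemann_zeta 1"
proof -
  obtain f where f: "f nicely_meromorphic_on UNIV" "\<forall>s. Re s > 1 \<longrightarrow> f s = zeta_series s"
      "f holomorphic_on -{1}" "is_pole f 1"
    using zeta_exists by blast
  have "riemann_zeta = f" using f(1,2) by (intro riemann_zeta_eqI) auto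
  with f show "riemann_zeta holomorphic_on -{1}" "is_pole riemann_zeta 1" by simp_all
qed

end

theory Submission
  imports Defs
begin

text \<open>
  Euler--Maclaurin summation with a fifth-order error term, started at \<open>n = 2\<close>, already separates the
  zeta function from 0 near \<open>\<bar>Im s\<bar> = 2\<pi>\<close>: there \<open>\<zeta>(s)\<close> is within \<open>0.32\<close> of
  \<open>1 + 2\<^sup>-\<^sup>s c\<close> with \<open>c = 1/2 + 2/(s - 1) + s/24\<close>, and \<open>\<bar>c\<bar> \<le> 0.61\<close> because the imaginary
  parts of \<open>2/(s - 1)\<close> and \<open>s/24\<close> have opposite signs.
\<close>

section \<open>The trapezoidal rule with first Euler-Maclaurin correction on one interval\<close>

text \<open>Reading \<open>D 1\<close> as the integrand and \<open>D 0\<close> as its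
  antiderivative, the weight 1/12 is B_2/2!, the first Euler-Maclaurin coefficient. Integrating the
  bound M u^2/12 three times from 0 produces M u^5/(12*3*4*5), hence the denominator 720.\<close>

lemma corrected_trapezoid_error:
  fixes D :: "nat \<Rightarrow> real \<Rightarrow> 'a::real_normed_vector"
  assumes "a \<le> b"
    and D: "\<And>i x. a \<le> x \<Longrightarrow> x \<le> b \<Longrightarrow> (D i has_vector_derivative D (Suc i) x) (at x)"
    and M: "\<And>x. a \<le> x \<Longrightarrow> x \<le> b \<Longrightarrow> norm (D 5 x) \<le> M"
  shows "norm (D 0 b - D 0 a - ((b - a) / 2) *\<^sub>R (D 1 b + D 1 a)
           + ((b - a)\<^sup>2 / 12) *\<^sub>R (D 2 b - D 2 a)) \<le> M * (b - a) ^ 5 / 720"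
proof -
  \<comment> \<open>As functions of the right end point, the error and its first two derivatives vanish at \<open>a\<close>,
      and its third derivative is \<open>(x - a)\<^sup>2 / 12\<close> times the fifth derivative of \<open>D 0\<close>.\<close>
  define E where "E = (\<lambda>x. D 0 x - D 0 a - ((x - a) / 2) *\<^sub>R (D 1 x + D 1 a)
           + ((x - a)\<^sup>2 / 12) *\<^sub>R (D 2 x - D 2 a))"
  define E1 where "E1 = (\<lambda>x. (1/2) *\<^sub>R (D 1 x - D 1 a) - ((x - a) / 3) *\<^sub>R D 2 x
           - ((x - a) / 6) *\<^sub>R D 2 a + ((x - a)\<^sup>2 / 12) *\<^sub>R D 3 x)"
  define E2 where "E2 = (\<lambda>x. (1/6) *\<^sub>R (D 2 x - D 2 a) - ((x - a) / 6) *\<^sub>R D 3 x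
           + ((x - a)\<^sup>2 / 12) *\<^sub>R D 4 x)"
  have D': "a \<le> x \<Longrightarrow> x \<le> b \<Longrightarrow> (D 0 has_vector_derivative D 1 x) (at x)"
           "a \<le> x \<Longrightarrow> x \<le> b \<Longrightarrow> (D 1 has_vector_derivative D 2 x) (at x)"
           "a \<le> x \<Longrightarrow> x \<le> b \<Longrightarrow> (D 2 has_vector_derivative D 3 x) (at x)"
           "a \<le> x \<Longrightarrow> x \<le> b \<Longrightarrow> (D 3 has_vector_derivative D 4 x) (at x)"
           "a \<le> x \<Longrightarrow> x \<le> b \<Longrightarrow> (D 4 has_vector_derivative D 5 x) (at x)" for x
    using D[of x 0] D[of x 1] D[of x 2] D[of x 3] D[of x 4] by (simp_all add: numeral_eq_Suc)
  have E: "(E has_vector_derivative E1 x) (at x)" if "a \<le> x" "x \<le> b" for x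
  proof -
    have "(E has_vector_derivative (D 1 x - (((x - a) / 2) *\<^sub>R D 2 x + (1/2) *\<^sub>R (D 1 x + D 1 a))
            + (((x - a)\<^sup>2 / 12) *\<^sub>R D 3 x + ((x - a) / 6) *\<^sub>R (D 2 x - D 2 a)))) (at x)"
      unfolding E_def
      by (rule derivative_eq_intros D'[OF that] refl | simp)+
    also have "D 1 x - (((x - a) / 2) *\<^sub>R D 2 x + (1/2) *\<^sub>R (D 1 x + D 1 a))
            + (((x - a)\<^sup>2 / 12) *\<^sub>R D 3 x + ((x - a) / 6) *\<^sub>R (D 2 x - D 2 a)) = E1 x"
    proof -
      define u where "u = x - a"
      have h: "D 1 x = (1/2) *\<^sub>R D 1 x + (1/2) *\<^sub>R D 1 x" "(u / 2) *\<^sub>R D 2 x = (u / 3) *\<^sub>R D 2 x + (u / 6) *\<^sub>R D 2 x"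
        by (simp_all flip: scaleR_add_left)
      show ?thesis unfolding E1_def u_def[symmetric]
        by (subst h(1), subst h(2)) (simp add: algebra_simps)
    qed
    finally show ?thesis .
  qed
  have E1: "(E1 has_vector_derivative E2 x) (at x)" if "a \<le> x" "x \<le> b" for x
  proof -
    have "(E1 has_vector_derivative ((1/2) *\<^sub>R D 2 x - (((x - a) / 3) *\<^sub>R D 3 x + (1/3) *\<^sub>R D 2 x)
            - (1/6) *\<^sub>R D 2 a + (((x - a)\<^sup>2 / 12) *\<^sub>R D 4 x + ((x - a) / 6) *\<^sub>R D 3 x))) (at x)"
      unfolding E1_def
      by (rule derivative_eq_intros D'[OF that] refl | simp)+
    also have "(1/2) *\<^sub>R D 2 x - (((x - a) / 3) *\<^sub>R D 3 x + (1/3) *\<^sub>R D 2 x)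
            - (1/6) *\<^sub>R D 2 a + (((x - a)\<^sup>2 / 12) *\<^sub>R D 4 x + ((x - a) / 6) *\<^sub>R D 3 x) = E2 x"
    proof -
      define u where "u = x - a"
      have h: "(1/2) *\<^sub>R D 2 x = (1/3) *\<^sub>R D 2 x + (1/6) *\<^sub>R D 2 x" "(u / 3) *\<^sub>R D 3 x = (u / 6) *\<^sub>R D 3 x + (u / 6) *\<^sub>R D 3 x"
        by (simp_all flip: scaleR_add_left)
      show ?thesis unfolding E2_def u_def[symmetric]
        by (subst h(1), subst h(2)) (simp add: algebra_simps)
    qed
    finally show ?thesis .
  qed
  \<comment> \<open>All terms in \<open>D 3 x\<close> and \<open>D 4 x\<close> cancel here, so only
    the fifth derivative has to be bounded.\<close>
  have E2: "(E2 has_vector_derivative ((x - a)\<^sup>2 / 12) *\<^sub>R D 5 x) (at x)" if "a \<le> x" "x \<le> b" for x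
    unfolding E2_def
    by (rule derivative_eq_intros D'[OF that] refl | simp)+
  have "0 \<le> norm (D 5 a)" by simp
  also have "\<dots> \<le> M" using M[of a] assms(1) by simp
  finally have M0: "0 \<le> M" .
  \<comment> \<open>A derivative bound is integrated by the mean value inequality against the
    antiderivative of c (y - a)^n; this needs no integral of a vector-valued function. Using it with
    n = 2, 3, 4 contributes the factors 3, 4, 5 of 720.\<close>
  have step: "norm (F x) \<le> c / real (Suc n) * (x - a) ^ Suc n"
    if "a \<le> x" "x \<le> b" "F a = 0"
      "\<And>y. a \<le> y \<Longrightarrow> y \<le> b \<Longrightarrow> (F has_vector_derivative F' y) (at y)"
      "\<And>y. a \<le> y \<Longrightarrow> y \<le> b \<Longrightarrow> norm (F' y) \<le> c * (y - a) ^ n"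
    for F F' :: "real \<Rightarrow> 'a" and c n x
  proof (cases "a = x")
    case False
    have "norm (F x - F a) \<le> c / real (Suc n) * (x - a) ^ Suc n - c / real (Suc n) * (a - a) ^ Suc n"
    proof (rule differentiable_bound_general[where f' = F' and \<phi>' = "\<lambda>y. c * (y - a) ^ n"])
      show "a < x" using that False by simp
      show "continuous_on {a..x} F"
        using that by (intro continuous_at_imp_continuous_on ballI has_vector_derivative_continuous[OF that(4)]) auto
      show "continuous_on {a..x} (\<lambda>y. c / real (Suc n) * (y - a) ^ Suc n)"
        by (intro continuous_intros)
      fix y assume y: "a < y" "y < x"
      have "((\<lambda>y. c / real (Suc n) * (y - a) ^ Suc n) has_real_derivative
              c / real (Suc n) * (real (Suc n) * (y - a) ^ n)) (at y)"
        by (auto intro!: derivative_eq_intros simp del: power_Suc)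
      thus "((\<lambda>y. c / real (Suc n) * (y - a) ^ Suc n) has_vector_derivative c * (y - a) ^ n) (at y)"
        by (simp add: has_real_derivative_iff_has_vector_derivative del: power_Suc)
    qed (use that in auto)
    thus ?thesis using that by simp
  qed (use that in simp)
  have b2: "norm (E2 x) \<le> M / 36 * (x - a) ^ 3" if "a \<le> x" "x \<le> b" for x
  proof -
    have "norm (E2 x) \<le> (M / 12) / real (Suc 2) * (x - a) ^ Suc 2"
    proof (rule step[OF that _ E2])
      show "norm (((y - a)\<^sup>2 / 12) *\<^sub>R D 5 y) \<le> M / 12 * (y - a)\<^sup>2" if "a \<le> y" "y \<le> b" for y
        using mult_left_mono[OF M[OF that], of "(y - a)\<^sup>2 / 12"] by (simp add: mult_ac)
    qed (auto simp: E2_def)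
    thus ?thesis by (simp add: eval_nat_numeral)
  qed
  have b1: "norm (E1 x) \<le> M / 144 * (x - a) ^ 4" if "a \<le> x" "x \<le> b" for x
  proof -
    have "norm (E1 x) \<le> (M / 36) / real (Suc 3) * (x - a) ^ Suc 3"
      by (rule step[OF that _ E1 b2]) (auto simp: E1_def)
    thus ?thesis by (simp add: eval_nat_numeral)
  qed
  have "norm (E b) \<le> (M / 144) / real (Suc 4) * (b - a) ^ Suc 4"
    by (rule step[OF assms(1) order.refl _ E b1]) (auto simp: E_def)
  thus ?thesis by (simp add: E_def eval_nat_numeral)
qed

section \<open>Euler-Maclaurin approximations and their convergence to zeta\<close>

text \<open>The half term is subtracted because the sum includes \<open>n powr (-s)\<close> in full; for \<open>n = 0\<close> the value is junk.\<close>
definition zeta_euler_maclaurin :: "nat \<Rightarrow> complex \<Rightarrow> complex" where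
  "zeta_euler_maclaurin n s = (\<Sum>k<n. of_nat (Suc k) powr (-s)) + of_nat n powr (1 - s) / (s - 1)
     - of_nat n powr (-s) / 2 + s * of_nat n powr (-s - 1) / 12"

lemma zeta_euler_maclaurin_holomorphic:
  "n > 0 \<Longrightarrow> zeta_euler_maclaurin n holomorphic_on -{1}"
proof -
  have "of_nat (Suc m) \<noteq> (0::complex)" for m using of_nat_neq_0 .
  then show "n > 0 \<Longrightarrow> ?thesis"
    unfolding zeta_euler_maclaurin_def[abs_def] by (intro holomorphic_intros) auto
qed

text \<open>Passing from n to n + 1 changes the approximation by exactly minus the corrected
  trapezoid error for x^(-s) on [n, n + 1]. The fourth derivative of x^(-s) is s(s+1)(s+2)(s+3)
  x^(-s-4), whose modulus is largest at the left end point because Re s > -4.\<close>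

lemma norm_zeta_euler_maclaurin_diff_le:
  assumes "s \<noteq> 1" "n > 0" "Re s > -4"
  shows "norm (zeta_euler_maclaurin n s - zeta_euler_maclaurin (Suc n) s)
           \<le> norm (s * (s + 1) * (s + 2) * (s + 3)) / 720 * real n powr (- Re s - 4)"
proof -
  \<comment> \<open>\<open>D i\<close> is the i-th derivative of x^(1-s)/(1-s), so that
    \<open>D 1\<close> is the summand x^(-s).\<close>
  define D where "D = (\<lambda>i x. ffac i (1 - s) / (1 - s) * complex_of_real x powr (1 - s - of_nat i))"
  define M where "M = norm (s * (s + 1) * (s + 2) * (s + 3)) * real n powr (- Re s - 4)"
  have ne: "1 - s \<noteq> 0" "s - 1 \<noteq> 0" using assms by auto
  have f: "ffac (Suc 0) (1 - s) / (1 - s) = 1" "ffac 2 (1 - s) / (1 - s) = -s"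
    "ffac 5 (1 - s) / (1 - s) = s * (s + 1) * (s + 2) * (s + 3)"
    using ne unfolding ffac_def by (simp_all add: eval_nat_numeral field_simps)
  have "norm (D 0 (real n + 1) - D 0 (real n) - ((real n + 1 - real n) / 2) *\<^sub>R (D 1 (real n + 1) + D 1 (real n))
           + ((real n + 1 - real n)\<^sup>2 / 12) *\<^sub>R (D 2 (real n + 1) - D 2 (real n))) \<le> M * (real n + 1 - real n) ^ 5 / 720"
  proof (rule corrected_trapezoid_error)
    fix x :: real and i assume x: "real n \<le> x" "x \<le> real n + 1"
    have x0: "x > 0" using x assms by linarith
    have "((\<lambda>z. ffac i (1 - s) / (1 - s) * z powr (1 - s - of_nat i)) has_field_derivative
            ffac i (1 - s) / (1 - s) * ((1 - s - of_nat i) * of_real x powr (1 - s - of_nat i - 1))) (at (of_real x))"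
      using x0 by (intro DERIV_cmult has_field_derivative_powr) auto
    hence "(D i has_vector_derivative 
            ffac i (1 - s) / (1 - s) * ((1 - s - of_nat i) * of_real x powr (1 - s - of_nat i - 1))) (at x)"
      unfolding D_def by (rule has_vector_derivative_real_field)
    also have "ffac i (1 - s) / (1 - s) * ((1 - s - of_nat i) * of_real x powr (1 - s - of_nat i - 1)) = D (Suc i) x"
      by (simp add: D_def ffac_def diff_diff_eq add.commute)
    finally show "(D i has_vector_derivative D (Suc i) x) (at x)" .
    have "norm (complex_of_real x powr (1 - s - of_nat 5)) = x powr (- Re s - 4)"
      using x0 by (subst norm_powr_real_powr) (simp_all add: algebra_simps)
    also have "\<dots> \<le> real n powr (- Re s - 4)"
      using x assms by (intro powr_mono2') auto
    finally show "norm (D 5 x) \<le> M" unfolding D_def M_def f norm_mult[of _ "_ powr _"]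
      by (intro mult_left_mono) auto
  qed simp
  also have "D 0 (real n + 1) - D 0 (real n) - ((real n + 1 - real n) / 2) *\<^sub>R (D 1 (real n + 1) + D 1 (real n))
           + ((real n + 1 - real n)\<^sup>2 / 12) *\<^sub>R (D 2 (real n + 1) - D 2 (real n)) = 
      zeta_euler_maclaurin n s - zeta_euler_maclaurin (Suc n) s"
  proof -
    have d0: "D 0 x = - (complex_of_real x powr (1 - s) / (s - 1))" for x
      using ne by (simp add: D_def ffac_def field_simps)
    have d1: "D 1 x = complex_of_real x powr (- s)" for x
      using f(1) by (simp add: D_def)
    have "1 - s - of_nat 2 = - s - 1" by simp
    hence d2: "D 2 x = - s * complex_of_real x powr (- s - 1)" for x
      unfolding D_def f(2) by (simp only:)
    have r: "of_nat (Suc n) = complex_of_real (real n + 1)" "of_nat n = complex_of_real (real n)" by simp_all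
    show ?thesis
      unfolding d0 d1 d2 zeta_euler_maclaurin_def sum.lessThan_Suc r scaleR_conv_of_real
      by (simp add: field_simps del: of_real_add of_real_of_nat_eq)
  qed
  finally show ?thesis by (simp add: M_def)
qed

lemma zeta_euler_maclaurin_tendsto_series:
  assumes "Re s > 1"
  shows "(\<lambda>n. zeta_euler_maclaurin n s) \<longlonglongrightarrow> zeta_series s"
proof -
  have lim: "(\<lambda>n. of_nat n powr w :: complex) \<longlonglongrightarrow> 0" if "Re w < 0" for w
  proof (rule tendsto_norm_zero_cancel)
    have "(\<lambda>n. real n powr Re w) \<longlonglongrightarrow> 0" using that by real_asymp
    also have "(\<lambda>n. real n powr Re w) = (\<lambda>n. norm (of_nat n powr w :: complex))"
      by (intro ext, subst norm_powr_real_powr) auto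
    finally show "(\<lambda>n. norm (of_nat n powr w :: complex)) \<longlonglongrightarrow> 0" .
  qed
  have "(\<lambda>n. zeta_euler_maclaurin n s) \<longlonglongrightarrow> zeta_series s + 0 / (s - 1) - 0 / 2 + s * 0 / 12"
    unfolding zeta_euler_maclaurin_def
    using assms by (intro tendsto_intros lim zeta_series_sums[unfolded sums_def]) auto
  thus ?thesis by simp
qed

text \<open>For Re s > 1 the series telescopes to its limit. Its terms are O(n^(-Re s - 4)), so it
  converges locally uniformly on Re s > -3, and the identity theorem on this half-plane without the
  point 1 extends the formula to the continuation.\<close>

lemma riemann_zeta_euler_maclaurin_sums:
  assumes "s \<noteq> 1" "Re s > -3" "N > 0"
  shows "(\<lambda>k. zeta_euler_maclaurin (N + k) s - zeta_euler_maclaurin (Suc (N + k)) s)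
           sums (zeta_euler_maclaurin N s - riemann_zeta s)"
proof -
  define d where "d = (\<lambda>k s. zeta_euler_maclaurin (N + k) s - zeta_euler_maclaurin (Suc (N + k)) s)"
  define A where "A = {s. Re s > -3} - {1::complex}"
  define C where "C = (\<lambda>s::complex. s * (s + 1) * (s + 2) * (s + 3) / 720)"
  have opA: "open A" unfolding A_def by (intro open_Diff open_halfspace_Re_gt) auto
  have d_le: "norm (d k s) \<le> norm (C s) * real (N + k) powr (- Re s - 4)" if "s \<in> A" for k s
    using norm_zeta_euler_maclaurin_diff_le[of s "N + k"] that \<open>N > 0\<close>
    by (simp add: d_def A_def C_def norm_divide)
  have summ: "summable (\<lambda>k. real (N + k) powr c)" if "c < -1" for c
    using that summable_iff_shift[of "\<lambda>k. real k powr c" N] summable_real_powr_iff[of c]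
    by (simp add: add.commute)
  have summ_d: "summable (\<lambda>k. d k s)" if "s \<in> A" for s
    by (rule summable_comparison_test'[OF summable_mult[OF summ] d_le[OF that]])
       (use that in \<open>auto simp: A_def\<close>)
  have holo: "(\<lambda>s. \<Sum>k. d k s) holomorphic_on A"
  proof (rule holomorphic_uniform_sequence[OF opA])
    show "(\<lambda>s. \<Sum>i<n. d i s) holomorphic_on A" for n
      unfolding d_def
      by (intro holomorphic_intros holomorphic_on_subset[OF zeta_euler_maclaurin_holomorphic])
         (use \<open>N > 0\<close> in \<open>auto simp: A_def\<close>)
    fix s0 assume "s0 \<in> A"
    then obtain r where r: "r > 0" "cball s0 r \<subseteq> A" using opA open_contains_cball by blast
    define c where "c = Re s0 - r"
    \<comment> \<open>The leftmost point of the disc lies in \<open>A\<close>; hence its real part c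
      exceeds -3 and the majorant with exponent -c - 4 < -1 is summable.\<close>
    have "s0 - of_real r \<in> cball s0 r" using r by (simp add: dist_norm)
    hence "s0 - of_real r \<in> A" using r by blast
    hence c: "c > -3" by (simp add: c_def A_def)
    have ge: "Re s \<ge> c" if "s \<in> cball s0 r" for s
    proof -
      have "\<bar>Re (s0 - s)\<bar> \<le> r" using that abs_Re_le_cmod[of "s0 - s"] by (simp add: dist_norm)
      thus ?thesis by (simp add: c_def)
    qed
    have "C holomorphic_on cball s0 r"
      unfolding C_def by (intro holomorphic_intros) auto
    hence "bounded (C ` cball s0 r)"
      by (intro compact_imp_bounded compact_continuous_image holomorphic_on_imp_continuous_on) auto
    then obtain B where B: "norm (C s) \<le> B" if "s \<in> cball s0 r" for s
      unfolding bounded_iff by blast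
    have "uniform_limit (cball s0 r) (\<lambda>n s. \<Sum>i<n. d i s) (\<lambda>s. \<Sum>n. d n s) sequentially"
    proof (rule Weierstrass_m_test)
      show "summable (\<lambda>k. B * real (N + k) powr (- c - 4))"
        using c by (intro summable_mult summ) auto
      fix k s assume s: "s \<in> cball s0 r"
      have "norm (d k s) \<le> norm (C s) * real (N + k) powr (- Re s - 4)"
        using s r by (intro d_le) auto
      also have "\<dots> \<le> B * real (N + k) powr (- c - 4)"
        using B[OF s] ge[OF s] \<open>N > 0\<close> by (intro mult_mono powr_mono order_trans[OF norm_ge_zero B[OF s]]) auto
      finally show "norm (d k s) \<le> B * real (N + k) powr (- c - 4)" .
    qed
    thus "\<exists>r>0. cball s0 r \<subseteq> A \<and> uniform_limit (cball s0 r) (\<lambda>n s. \<Sum>i<n. d i s) (\<lambda>s. \<Sum>n. d n s) sequentially"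
      using r by blast
  qed
  have "zeta_euler_maclaurin N s - (\<Sum>k. d k s) = riemann_zeta s"
  proof (rule analytic_continuation_open[where f = "\<lambda>s. zeta_euler_maclaurin N s - (\<Sum>k. d k s)"
      and g = riemann_zeta and s = "{s. Re s > 1}" and s' = A])
    show "{s. Re s > 1} \<noteq> {}" by (auto intro: exI[of _ 2])
    show "connected A" unfolding A_def
      by (intro connected_open_delete convex_connected convex_halfspace_Re_gt open_halfspace_Re_gt) auto
    show "(\<lambda>s. zeta_euler_maclaurin N s - (\<Sum>k. d k s)) holomorphic_on A"
    proof (rule holomorphic_on_diff[OF _ holo])
      show "zeta_euler_maclaurin N holomorphic_on A"
        by (rule holomorphic_on_subset[OF zeta_euler_maclaurin_holomorphic[OF \<open>N > 0\<close>]]) (auto simp: A_def)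
    qed
    show "riemann_zeta holomorphic_on A"
      by (rule holomorphic_on_subset[OF riemann_zeta_holomorphic]) (auto simp: A_def)
    fix s assume s: "s \<in> {s. Re s > 1}"
    have "(\<lambda>k. zeta_euler_maclaurin (k + N) s) \<longlonglongrightarrow> zeta_series s"
      using zeta_euler_maclaurin_tendsto_series[of s] s by (intro LIMSEQ_ignore_initial_segment) auto
    from telescope_sums'[OF this] have "(\<Sum>k. d k s) = zeta_euler_maclaurin N s - zeta_series s"
      by (simp add: d_def add.commute sums_iff)
    thus "zeta_euler_maclaurin N s - (\<Sum>k. d k s) = riemann_zeta s"
      using riemann_zeta_eq_series[of s] s by simp
  qed (use assms opA in \<open>auto simp: A_def open_halfspace_Re_gt\<close>)
  moreover have "(\<lambda>k. d k s) sums (\<Sum>k. d k s)"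
    using assms by (intro summable_sums summ_d) (auto simp: A_def)
  moreover have "x = z - y" if "z - x = y" for x y z :: complex
    using that by auto
  ultimately show ?thesis unfolding d_def by metis
qed

section \<open>Explicit approximation of zeta from two terms\<close>

text \<open>By convexity n^(-4) is at most the integral of x^(-4) over [n - 1/2, n + 1/2]. Summing
  over n >= 2 gives the integral from 3/2 to infinity, which is 8/81, and (8/81)/720 =
  1/7290.\<close>

lemma norm_zeta_euler_maclaurin_2_minus_zeta_le:
  assumes "s \<noteq> 1" "Re s \<ge> 0"
  shows "norm (zeta_euler_maclaurin 2 s - riemann_zeta s) \<le> norm (s * (s + 1) * (s + 2) * (s + 3)) / 7290"
proof -
  define C where "C = norm (s * (s + 1) * (s + 2) * (s + 3)) / 720"
  \<comment> \<open>\<open>h k\<close> is the integral of x^(-4) from k + 3/2 to infinity; the index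
    k belongs to n = k + 2.\<close>
  define h where "h = (\<lambda>k. 1 / (3 * (real k + 3/2) ^ 3))"
  have "h \<longlonglongrightarrow> 0" unfolding h_def by real_asymp
  from telescope_sums'[OF this] have "(\<lambda>k. h k - h (Suc k)) sums (8/81)"
    by (simp add: h_def power3_eq_cube)
  hence h: "(\<lambda>k. C * (h k - h (Suc k))) sums (C * (8/81))" by (rule sums_mult)
  have le: "real (2 + k) powr (- Re s - 4) \<le> h k - h (Suc k)" for k
  proof -
    define u where "u = real k + 2"
    have u: "u \<ge> 2" by (simp add: u_def)
    have "real (2 + k) powr (- Re s - 4) \<le> u powr (-4)"
      using assms u by (simp add: u_def add.commute powr_mono)
    also have "\<dots> = 1 / u ^ 4" using u powr_realpow[of u 4] by (simp add: powr_minus_divide)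
    \<comment> \<open>The right-hand side is the integral of x^(-4) over [u - 1/2, u + 1/2] in
      closed form, brought over a common denominator.\<close>
    also have "\<dots> \<le> (u\<^sup>2 + 1/12) / (u\<^sup>2 - 1/4) ^ 3"
    proof -
      have u2: "u\<^sup>2 \<ge> 4" using power_mono[OF u, of 2] by simp
      define v where "v = u\<^sup>2"
      have "(v - 1/4) ^ 3 \<le> (v + 1/12) * v\<^sup>2"
      proof -
        have "(v + 1/12) * v\<^sup>2 - (v - 1/4) ^ 3 = (5/6) * v\<^sup>2 - 3/16 * v + 1/64"
          by (simp add: power2_eq_square power3_eq_cube field_simps)
        moreover have "v\<^sup>2 \<ge> 4 * v" using u2 unfolding v_def[symmetric] by (simp add: power2_eq_square mult_right_mono)
        ultimately show ?thesis using u2 unfolding v_def by linarith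
      qed
      moreover have "u ^ 4 = v\<^sup>2" by (simp add: v_def)
      moreover have "v > 1/4" using u2 by (simp add: v_def)
      moreover have "1 / a \<le> b / w" if "w \<le> b * a" "a > 0" "w > 0" for a b w :: real
        using that by (simp add: field_simps)
      ultimately show ?thesis using u unfolding v_def[symmetric] by simp
    qed
    also have "\<dots> = 1 / (3 * (u - 1/2) ^ 3) - 1 / (3 * (u + 1/2) ^ 3)"
    proof -
      have "u\<^sup>2 - 1/4 = (u - 1/2) * (u + 1/2)" by (simp add: power2_eq_square algebra_simps)
      hence "(u\<^sup>2 - 1/4) ^ 3 = (u - 1/2) ^ 3 * (u + 1/2) ^ 3" by (simp add: power_mult_distrib)
      moreover have "3 * (u\<^sup>2 + 1/12) = (u + 1/2) ^ 3 - (u - 1/2) ^ 3"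
        by (simp add: power2_eq_square power3_eq_cube algebra_simps)
      moreover have "(u - 1/2) ^ 3 > 0" "(u + 1/2) ^ 3 > 0" using u by simp_all
      moreover have "w / (p * q) = 1 / (3 * p) - 1 / (3 * q)" if "3 * w = q - p" "p > 0" "q > 0" for w p q :: real
        using that by (simp add: field_simps)
      ultimately show ?thesis by metis
    qed
    also have "\<dots> = h k - h (Suc k)"
    proof -
      have "u - 1/2 = real k + 3/2" "u + 1/2 = real (Suc k) + 3/2" by (simp_all add: u_def)
      thus ?thesis by (simp only: h_def)
    qed
    finally show ?thesis .
  qed
  have bound: "norm (zeta_euler_maclaurin (2 + k) s - zeta_euler_maclaurin (Suc (2 + k)) s) \<le> C * (h k - h (Suc k))" for k
  proof -
    have "norm (zeta_euler_maclaurin (2 + k) s - zeta_euler_maclaurin (Suc (2 + k)) s) \<le> C * real (2 + k) powr (- Re s - 4)"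
      unfolding C_def using assms by (intro norm_zeta_euler_maclaurin_diff_le) auto
    also have "\<dots> \<le> C * (h k - h (Suc k))"
      using le by (intro mult_left_mono) (auto simp: C_def)
    finally show ?thesis .
  qed
  have "zeta_euler_maclaurin 2 s - riemann_zeta s = 
     (\<Sum>k. zeta_euler_maclaurin (2 + k) s - zeta_euler_maclaurin (Suc (2 + k)) s)"
    using assms by (intro sums_unique riemann_zeta_euler_maclaurin_sums) auto
  also have "norm \<dots> \<le> (\<Sum>k. C * (h k - h (Suc k)))"
    using h by (intro norm_suminf_le bound) (auto simp: sums_iff)
  also have "\<dots> = C * (8/81)" using h by (simp add: sums_iff)
  finally show ?thesis by (simp add: C_def)
qed

lemma zeta_euler_maclaurin_2:
  "zeta_euler_maclaurin 2 s = 1 + 2 powr (-s) * (1 / 2 + 2 / (s - 1) + s / 24)"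
proof -
  have "(2::complex) powr (1 - s) = 2 * 2 powr (-s)" "(2::complex) powr (-s - 1) = 2 powr (-s) / 2"
    using powr_add[of 2 1 "-s"] powr_diff[of 2 "-s" 1] by simp_all
  thus ?thesis
    by (simp add: zeta_euler_maclaurin_def eval_nat_numeral algebra_simps)
qed

section \<open>Non-vanishing near height 2 pi\<close>

text \<open>At a zero the two-term approximation would have modulus at most 2300/7290 < 0.32,
  whereas the bound 0.61 on the term beside 1 keeps it at least 0.39.\<close>

lemma riemann_zeta_nonzero:
  assumes "0 \<le> Re s" "Re s \<le> 1" "6 \<le> \<bar>Im s\<bar>" "\<bar>Im s\<bar> \<le> 6.33"
  shows "riemann_zeta s \<noteq> 0"
proof
  assume zero: "riemann_zeta s = 0"
  define \<sigma> t where "\<sigma> = Re s" and "t = Im s"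
  have s: "s = Complex \<sigma> t" by (simp add: \<sigma>_def t_def)
  have \<sigma>: "0 \<le> \<sigma>" "\<sigma> \<le> 1" using assms by (auto simp: \<sigma>_def)
  have "t\<^sup>2 \<ge> 6\<^sup>2" using assms(3) abs_le_square_iff[of 6 t] by (simp add: t_def)
  hence t1: "t\<^sup>2 \<ge> 36" by simp
  have "t\<^sup>2 \<le> 6.33\<^sup>2" using assms(4) abs_le_square_iff[of t "6.33"] by (simp add: t_def)
  hence t2: "t\<^sup>2 \<le> 40.0689" by (simp add: power2_eq_square)
  have ne: "s \<noteq> 1" using assms by auto
  \<comment> \<open>\<open>q\<close> is |s - 1|^2, the denominator of both the real and the
    imaginary part of 2/(s - 1).\<close>
  define q where "q = (\<sigma> - 1)\<^sup>2 + t\<^sup>2"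
  have "(\<sigma> - 1)\<^sup>2 \<ge> 0" by simp
  hence q: "q \<ge> 36" using t1 unfolding q_def by linarith
  define c where "c = 1 / 2 + 2 / (s - 1) + s / 24"
  have i: "inverse q \<ge> 0" "inverse q \<le> 1/36" using q le_imp_inverse_le[of 36 q] by auto
  have "Re (2 / (s - 1)) = 2 * (\<sigma> - 1) / q"
    by (simp add: s Re_divide q_def)
  also have "\<dots> = - 2 * ((1 - \<sigma>) * inverse q)"
    by (simp only: divide_inverse) (simp add: left_diff_distrib)
  finally have "Re c = 1/2 + \<sigma>/24 - 2 * ((1 - \<sigma>) * inverse q)"
    by (simp add: c_def s)
  moreover have "0 \<le> (1 - \<sigma>) * inverse q" "(1 - \<sigma>) * inverse q \<le> 1 * (1/36)"
    using \<sigma> i by (intro mult_nonneg_nonneg mult_mono; simp)+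
  \<comment> \<open>From above Re c <= 1/2 + 1/24 = 13/24; from below Re c >= 1/2 - 1/18 >
    0.\<close>
  ultimately have "\<bar>Re c\<bar> \<le> 13/24" using \<sigma> by simp
  hence re: "(Re c)\<^sup>2 \<le> (13/24)\<^sup>2" using abs_le_square_iff[of "Re c" "13/24"] by simp
  have "Im c = t * (1/24 - 2 * inverse q)"
    by (simp add: c_def s Im_divide q_def field_simps)
  hence "(Im c)\<^sup>2 = t\<^sup>2 * (1/24 - 2 * inverse q)\<^sup>2" by (simp add: power_mult_distrib)
  also have "\<dots> \<le> 40.0689 * (1/24)\<^sup>2"
  proof (intro mult_mono t2)
    \<comment> \<open>Since 0 <= 2/q <= 1/18 < 1/12, subtracting it from 1/24 cannot increase the
      modulus.\<close>
    have "\<bar>1/24 - 2 * inverse q\<bar> \<le> 1/24" using i unfolding abs_le_iff by linarith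
    thus "(1/24 - 2 * inverse q)\<^sup>2 \<le> (1/24)\<^sup>2" using abs_le_square_iff[of _ "1/24::real"] by simp
  qed auto
  finally have "(norm c)\<^sup>2 \<le> (13/24)\<^sup>2 + 40.0689 * (1/24)\<^sup>2"
    using re by (simp add: cmod_power2)
  also have "\<dots> \<le> 0.61\<^sup>2" by (simp add: power2_eq_square)
  finally have c: "norm c \<le> 0.61" by (rule power2_le_imp_le) simp
  have "norm (2 powr (-s)) = 2 powr (-\<sigma>)" by (subst norm_powr_real_powr) (auto simp: \<sigma>_def)
  also have "\<dots> \<le> 2 powr 0" using \<sigma> by (intro powr_mono) auto
  finally have p: "norm (2 powr (-s) * c) \<le> 1 * 0.61"
    unfolding norm_mult using c by (intro mult_mono) auto
  have n: "(norm (s + of_nat k))\<^sup>2 \<le> (1 + real k)\<^sup>2 + 40.0689" for k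
  proof -
    have "(\<sigma> + real k)\<^sup>2 \<le> (1 + real k)\<^sup>2" using \<sigma> by (intro power_mono) auto
    thus ?thesis using t2 by (simp add: cmod_power2 s)
  qed
  have "(norm (s * (s + 1) * (s + 2) * (s + 3)))\<^sup>2 = 
     (norm (s + of_nat 0))\<^sup>2 * (norm (s + of_nat 1))\<^sup>2 * (norm (s + of_nat 2))\<^sup>2 * (norm (s + of_nat 3))\<^sup>2"
    by (simp add: norm_mult power_mult_distrib)
  also have "\<dots> \<le> ((1 + real 0)\<^sup>2 + 40.0689) * ((1 + real 1)\<^sup>2 + 40.0689) * ((1 + real 2)\<^sup>2 + 40.0689) * ((1 + real 3)\<^sup>2 + 40.0689)"
    by (intro mult_mono n) auto
  \<comment> \<open>The square root of the product is about 2231; 2300 is a rounded value that still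
    leaves 2300/7290 below 0.39.\<close>
  also have "\<dots> \<le> 2300\<^sup>2" by (simp add: power2_eq_square)
  finally have r: "norm (s * (s + 1) * (s + 2) * (s + 3)) \<le> 2300" by (rule power2_le_imp_le) simp
  have "norm (1 + 2 powr (-s) * c) \<le> 2300 / 7290"
    using norm_zeta_euler_maclaurin_2_minus_zeta_le[OF ne] assms r
    unfolding zero zeta_euler_maclaurin_2 c_def by simp
  moreover have "1 - norm (2 powr (-s) * c) \<le> norm (1 + 2 powr (-s) * c)"
    using norm_diff_ineq[of 1 "2 powr (-s) * c"] by simp
  ultimately show False using p by simp
qed

theorem lemma5:
  "\<not> (\<exists>\<sigma> t :: real. nontrivial_zeta_zero (Complex \<sigma> t) \<and>
        2 * pi < \<bar>t\<bar> \<and> \<bar>t\<bar> < kappa \<and>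
        (0 \<le> \<sigma> \<and> \<sigma> < 1 / 2 \<or> 1 / 2 < \<sigma> \<and> \<sigma> \<le> 1))"
proof clarify
  fix \<sigma> t :: real
  assume z: "nontrivial_zeta_zero (Complex \<sigma> t)" and t: "2 * pi < \<bar>t\<bar>" "\<bar>t\<bar> < kappa"
    and \<sigma>: "0 \<le> \<sigma> \<and> \<sigma> < 1 / 2 \<or> 1 / 2 < \<sigma> \<and> \<sigma> \<le> 1"
  \<comment> \<open>The window fits into the range just treated, because 6 < 2 pi and 2.01 pi <
    6.33.\<close>
  have "riemann_zeta (Complex \<sigma> t) \<noteq> 0"
    using t \<sigma> pi_approx by (intro riemann_zeta_nonzero) (auto simp: kappa_def)
  with z show False by (simp add: nontrivial_zeta_zero_def)
qed

end
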